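(* Let $M=(m_{i,j})$ be an $n\times n$ binary matrix ($1\le i,j\le n$). Then the scheme $S(M)$ is optimal if and only if $M$ is $k$-uniform for some $k$ with $0\le k\le n$ and, for each $j$ with $1\le j\le n-1$, there exists an assignment mapping $\phi_j$ such that (1) for every $i$ in the domain of $\phi_j$: $\phi_j(i)=i$ if and only if $m_{i,j}=m_{i,j+1}=1$; and (2) for every $i$ in the domain of $\phi_j$, writing $i'=\phi_j(i)$: $\sum_{l=1}^{j}m_{i',l}\le\sum_{l=1}^{j}m_{i,l}$.
   Context: Biker–hiker model: there are $n$ travellers $t_1,\dots,t_n$; the route has staging posts $P_0,P_1,\dots,P_n$ at unit spacing, and stage $s_j$ is the leg from $P_{j-1}$ to $P_j$ ($1\le j\le n$). All travellers start at $P_0$ at time $0$, every traveller walks at the same speed $w$ and cycles at the same speed $v>w$, and changing mode takes no time. An $n\times n$ binary matrix $M=(m_{i,j})$ defines the scheme $S(M)$: $t_i$ cycles stage $s_j$ if $m_{i,j}=1$ and walks it if $m_{i,j}=0$. $M$ is $k$-uniform if each row and each column of $M$ contains exactly $k$ entries equal to $1$. Bicycles start at $P_0$, move only when ridden (one rider at a time), and a traveller due to cycle $s_j$ must, upon arriving at $P_{j-1}$, take a bicycle that is present at $P_{j-1}$ at that moment (one he rode over $s_{j-1}$, or one left at $P_{j-1}$ by a traveller who rode $s_{j-1}$). $M$ (equivalently $S(M)$) is called optimal if $M$ is $k$-uniform for some $k$ and, with $k$ bicycles, the scheme $S(M)$ can be executed without any traveller ever having to wait at a post for a bicycle. For $1\le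 j\le n-1$, an assignment mapping $\phi_j$ is a one-to-one map from $\{i: m_{i,j}=1\}$ onto $\{i: m_{i,j+1}=1\}$ (interpreted as: the bicycle ridden by $t_i$ on $s_j$ is ridden by $t_{\phi_j(i)}$ on $s_{j+1}$). *)

theory Defs
  imports Complex_Main
begin

text \<open>
  Travellers and stages are numbered \<open>1, ..., n\<close>, posts \<open>0, ..., n\<close>; a matrix is a function
  \<open>M :: nat \<Rightarrow> nat \<Rightarrow> nat\<close>, read only at indices in \<open>{1..n}\<close>.  Stage \<open>j\<close> is the unit-length leg
  from post \<open>j - 1\<close> to post \<open>j\<close>.
\<close>

definition binary_matrix :: "nat \<Rightarrow> (nat \<Rightarrow> nat \<Rightarrow> nat) \<Rightarrow> bool" where
  "binary_matrix n M \<longleftrightarrow> (\<forall>i\<in>{1..n}. \<forall>j\<in>{1..n}. M i j \<in> {0, 1})"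

definition uniform_matrix :: "nat \<Rightarrow> nat \<Rightarrow> (nat \<Rightarrow> nat \<Rightarrow> nat) \<Rightarrow> bool" where
  "uniform_matrix n k M \<longleftrightarrow>
     (\<forall>i\<in>{1..n}. card {j\<in>{1..n}. M i j = 1} = k) \<and>
     (\<forall>j\<in>{1..n}. card {i\<in>{1..n}. M i j = 1} = k)"

text \<open>
  Time at which traveller \<open>i\<close> reaches post \<open>j\<close> when never waiting, with cycling speed \<open>v\<close> and
  walking speed \<open>w\<close>.  Without waiting this is also the departure time on stage \<open>j + 1\<close>.
\<close>

definition arrival_time :: "real \<Rightarrow> real \<Rightarrow> (nat \<Rightarrow> nat \<Rightarrow> nat) \<Rightarrow> nat \<Rightarrow> nat \<Rightarrow> real" where
  "arrival_time v w M i j = (\<Sum>l=1..j. if M i l = 1 then 1 / v else 1 / w)"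

text \<open>
  A bicycle allocation \<open>b\<close> says that traveller \<open>i\<close> uses bicycle \<open>b i j\<close> on stage \<open>j\<close>; its value is
  irrelevant on stages that are walked.
\<close>

definition rides ::
  "nat \<Rightarrow> (nat \<Rightarrow> nat \<Rightarrow> nat) \<Rightarrow> (nat \<Rightarrow> nat \<Rightarrow> nat) \<Rightarrow> nat \<Rightarrow> nat \<Rightarrow> nat \<Rightarrow> bool" where
  "rides n M b i j c \<longleftrightarrow> i \<in> {1..n} \<and> j \<in> {1..n} \<and> M i j = 1 \<and> b i j = c"

text \<open>
  Bicycle \<open>c\<close> is at post \<open>p\<close> at time \<open>t\<close>: it started there or was ridden there no later than \<open>t\<close>,
  and nobody has ridden it away strictly before \<open>t\<close>.  A bicycle that arrives, or departs, exactly
  at time \<open>t\<close> counts as present; simultaneous departures of two travellers on one bicycle are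
  excluded by the one-rider condition in \<open>executable\<close>.  Since travel is only forward, a bicycle
  ridden away from a post never returns to it.
\<close>

definition bicycle_present ::
  "real \<Rightarrow> real \<Rightarrow> nat \<Rightarrow> (nat \<Rightarrow> nat \<Rightarrow> nat) \<Rightarrow> (nat \<Rightarrow> nat \<Rightarrow> nat) \<Rightarrow> nat \<Rightarrow> nat \<Rightarrow> real \<Rightarrow> bool" where
  "bicycle_present v w n M b c p t \<longleftrightarrow>
     ((p = 0 \<and> 0 \<le> t) \<or> (\<exists>h. rides n M b h p c \<and> arrival_time v w M h p \<le> t)) \<and>
     (\<forall>h. rides n M b h (p + 1) c \<longrightarrow> t \<le> arrival_time v w M h p)"

text \<open>
  The scheme of \<open>M\<close> can be executed with the \<open>k\<close> bicycles \<open>{..<k}\<close> and no waiting.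
\<close>

definition executable :: "real \<Rightarrow> real \<Rightarrow> nat \<Rightarrow> (nat \<Rightarrow> nat \<Rightarrow> nat) \<Rightarrow> nat \<Rightarrow> bool" where
  "executable v w n M k \<longleftrightarrow> (\<exists>b.
     (\<forall>i\<in>{1..n}. \<forall>j\<in>{1..n}. M i j = 1 \<longrightarrow>
        b i j < k \<and> bicycle_present v w n M b (b i j) (j - 1) (arrival_time v w M i (j - 1))) \<and>
     (\<forall>c i j i' j'. rides n M b i j c \<and> rides n M b i' j' c \<and> i \<noteq> i' \<longrightarrow>
        {arrival_time v w M i (j - 1) <..< arrival_time v w M i j} \<inter>
        {arrival_time v w M i' (j' - 1) <..< arrival_time v w M i' j'} = {}))"

definition optimal :: "real \<Rightarrow> real \<Rightarrow> nat \<Rightarrow> (nat \<Rightarrow> nat \<Rightarrow> nat) \<Rightarrow> bool" where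
  "optimal v w n M \<longleftrightarrow> (\<exists>k. uniform_matrix n k M \<and> executable v w n M k)"

definition assignment_mapping ::
  "nat \<Rightarrow> (nat \<Rightarrow> nat \<Rightarrow> nat) \<Rightarrow> nat \<Rightarrow> (nat \<Rightarrow> nat) \<Rightarrow> bool" where
  "assignment_mapping n M j \<phi> \<longleftrightarrow>
     bij_betw \<phi> {i\<in>{1..n}. M i j = 1} {i\<in>{1..n}. M i (j + 1) = 1}"

end

theory Submission
  imports Defs "HOL-Combinatorics.Transposition"
begin

text \<open>
  A traveller who has cycled \<open>s\<close> of the first \<open>j\<close> stages reaches post \<open>j\<close> at time
  \<open>j/w - (1/w - 1/v) s\<close>, so condition (2) says exactly that \<open>i\<close> reaches post \<open>j\<close> no later than
  the traveller \<open>\<phi>\<^sub>j(i)\<close> who takes over his bicycle.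

  In an execution with \<open>k\<close> bicycles the \<open>k\<close> riders of each stage use \<open>k\<close> distinct bicycles, and
  following a bicycle from one stage to the next gives a bijection satisfying (2).  Two riders
  who swap bicycles violate (1), which is repaired by shortcuts: if \<open>y \<mapsto> x \<mapsto> z\<close> and \<open>x\<close> cycles
  both stages, replace this by \<open>x \<mapsto> x\<close> and \<open>y \<mapsto> z\<close>.  Conversely, handing the bicycles on along
  the \<open>\<phi>\<^sub>j\<close> makes each bicycle travel through the stages in chronological order.
\<close>

abbreviation riders :: "nat \<Rightarrow> (nat \<Rightarrow> nat \<Rightarrow> nat) \<Rightarrow> nat \<Rightarrow> nat set" where
  "riders n M j \<equiv> {i \<in> {1..n}. M i j = 1}"

section \<open>Shortcuts in order-decreasing bijections\<close>

text \<open>Induction on \<open>F\<close>, precomposing with the transposition of \<open>x\<close>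
  and its preimage \<open>y\<close>. Afterwards \<open>x\<close> is fixed and \<open>y\<close> goes
  to \<open>\<psi> x\<close>, where \<open>s (\<psi> x) \<le> s x \<le> s y\<close>.\<close>

lemma bij_betw_fix_common_points:
  fixes s :: "'a \<Rightarrow> 'b::preorder"
  assumes bij: "bij_betw \<phi> A B" and dec: "\<And>x. x \<in> A \<Longrightarrow> s (\<phi> x) \<le> s x"
    and "finite F" and "F \<subseteq> A \<inter> B"
  shows "\<exists>\<psi>. bij_betw \<psi> A B \<and> (\<forall>x\<in>A. s (\<psi> x) \<le> s x) \<and> (\<forall>x\<in>F. \<psi> x = x)"
  using assms(3,4)
proof (induction F)
  case empty
  then show ?case using bij dec by auto
next
  case (insert x F)
  then obtain \<psi> where \<psi>: "bij_betw \<psi> A B" "\<And>x. x \<in> A \<Longrightarrow> s (\<psi> x) \<le> s x" "\<And>x. x \<in> F \<Longrightarrow> \<psi> x = x"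
    by auto
  have x: "x \<in> A" "x \<in> B" using insert.prems by auto
  obtain y where y: "y \<in> A" "\<psi> y = x"
    using \<psi>(1) x(2) by (metis bij_betw_imp_surj_on imageE)
  let ?\<tau> = "transpose x y"
  have "bij_betw ?\<tau> A A"
    using x(1) y(1) by (simp add: transpose_def bij_betw_def inj_on_def) force
  then have "bij_betw (\<psi> \<circ> ?\<tau>) A B"
    using \<psi>(1) by (rule bij_betw_trans)
  moreover have "s ((\<psi> \<circ> ?\<tau>) z) \<le> s z" if "z \<in> A" for z
  proof -
    have "s (\<psi> x) \<le> s x" "s x \<le> s y" using \<psi>(2)[OF x(1)] \<psi>(2)[OF y(1)] y(2) by auto
    then have "s (\<psi> x) \<le> s y" by (rule order_trans)
    then show ?thesis using \<psi>(2)[OF that] y(2) by (auto simp: transpose_def)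
  qed
  \<comment> \<open>Earlier fixed points survive: \<open>y \<in> F\<close> would give
    \<open>y = \<psi> y = x\<close>, but \<open>x \<notin> F\<close>.\<close>
  moreover have "(\<psi> \<circ> ?\<tau>) z = z" if "z \<in> insert x F" for z
    using that insert.hyps(2) \<psi>(3) y(2) by (auto simp: transpose_def)
  ultimately show ?case by blast
qed

section \<open>Arrival times and ride counts\<close>

lemma arrival_time_eq:
  assumes "binary_matrix n M" "i \<in> {1..n}" "j \<le> n"
  shows "arrival_time v w M i j = real j / w - (1 / w - 1 / v) * real (\<Sum>l=1..j. M i l)"
  using assms(3)
proof (induction j)
  case 0
  then show ?case by (simp add: arrival_time_def)
next
  case (Suc j)
  have "Suc j \<in> {1..n}" using Suc.prems by simp
  then have "M i (Suc j) = 0 \<or> M i (Suc j) = 1"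
    using assms(1,2) unfolding binary_matrix_def by blast
  then show ?case
    using Suc by (auto simp: arrival_time_def algebra_simps add_divide_distrib)
qed

lemma arrival_time_le_iff:
  assumes "0 < w" "w < v" "binary_matrix n M" "i \<in> {1..n}" "i' \<in> {1..n}" "j \<le> n"
  shows "arrival_time v w M i j \<le> arrival_time v w M i' j
    \<longleftrightarrow> (\<Sum>l=1..j. M i' l) \<le> (\<Sum>l=1..j. M i l)"
proof -
  have "0 < 1 / w - 1 / v" using assms(1,2) by (simp add: frac_less2)
  then show ?thesis
    unfolding arrival_time_eq[OF assms(3,4,6)] arrival_time_eq[OF assms(3,5,6)]
    by (simp del: of_nat_sum)
qed

lemma arrival_time_less_Suc:
  assumes "0 < w" "0 < v"
  shows "arrival_time v w M i j < arrival_time v w M i (Suc j)"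
  using assms by (simp add: arrival_time_def)

section \<open>From executions to assignment mappings\<close>

text \<open>Two riders sharing a bicycle on one stage must each find it not yet taken, so neither
  leaves after the other. They then ride during the same nonempty time interval, against the
  one-rider condition.\<close>

lemma inj_on_riders_if_present:
  assumes "0 < w" "0 < v" "1 \<le> j" "j \<le> n"
    and present: "\<And>i. i \<in> riders n M j \<Longrightarrow>
      bicycle_present v w n M b (b i j) (j - 1) (arrival_time v w M i (j - 1))"
    and disjoint: "\<And>c i i'. rides n M b i j c \<Longrightarrow> rides n M b i' j c \<Longrightarrow> i \<noteq> i' \<Longrightarrow>
      {arrival_time v w M i (j - 1) <..< arrival_time v w M i j} \<inter>
      {arrival_time v w M i' (j - 1) <..< arrival_time v w M i' j} = {}"
  shows "inj_on (\<lambda>i. b i j) (riders n M j)"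
proof (rule inj_onI, rule ccontr)
  fix i i' assume i: "i \<in> riders n M j" "i' \<in> riders n M j" "b i j = b i' j" "i \<noteq> i'"
  have j: "Suc (j - 1) = j" using assms(3) by simp
  have r: "rides n M b i j (b i j)" "rides n M b i' j (b i j)"
    using i assms(3,4) by (auto simp: rides_def)
  have eq: "arrival_time v w M i (j - 1) = arrival_time v w M i' (j - 1)"
    using present[OF i(1)] present[OF i(2)] r i(3) j
    by (auto simp: bicycle_present_def intro!: antisym)
  have "arrival_time v w M i j = arrival_time v w M i' j"
    using eq i(1,2) assms(3) by (cases j) (simp_all add: arrival_time_def)
  then have "{arrival_time v w M i (j - 1) <..< arrival_time v w M i j} = {}"
    using disjoint[OF r i(4)] eq by simp
  then show False
    using arrival_time_less_Suc[OF assms(1,2), of M i "j - 1"] j by simp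
qed

lemma assignment_mapping_if_executable:
  assumes "0 < w" "w < v" "binary_matrix n M" "uniform_matrix n k M" "executable v w n M k"
    and "1 \<le> j" "j < n"
  obtains \<phi> where "assignment_mapping n M j \<phi>"
    and "\<And>i. i \<in> riders n M j \<Longrightarrow> (\<Sum>l=1..j. M (\<phi> i) l) \<le> (\<Sum>l=1..j. M i l)"
    and "\<And>i. i \<in> riders n M j \<Longrightarrow> \<phi> i = i \<longleftrightarrow> M i (j + 1) = 1"
proof -
  have "0 < v" using assms(1,2) by simp
  obtain b where lt: "\<And>i j. i \<in> {1..n} \<Longrightarrow> j \<in> {1..n} \<Longrightarrow> M i j = 1 \<Longrightarrow> b i j < k"
    and present: "\<And>i j. i \<in> {1..n} \<Longrightarrow> j \<in> {1..n} \<Longrightarrow> M i j = 1 \<Longrightarrow>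
        bicycle_present v w n M b (b i j) (j - 1) (arrival_time v w M i (j - 1))"
    and disjoint: "\<And>c i j i' j'. rides n M b i j c \<Longrightarrow> rides n M b i' j' c \<Longrightarrow> i \<noteq> i' \<Longrightarrow>
        {arrival_time v w M i (j - 1) <..< arrival_time v w M i j} \<inter>
        {arrival_time v w M i' (j' - 1) <..< arrival_time v w M i' j'} = {}"
    using assms(5) unfolding executable_def by (elim exE conjE) blast
  \<comment> \<open>Uniformity matches the \<open>k\<close> riders of a stage with the
    \<open>k\<close> bicycles, so the injection is onto and can be inverted.\<close>
  have bij: "bij_betw (\<lambda>i. b i j) (riders n M j) {..<k}" if j: "1 \<le> j" "j \<le> n" for j
  proof -
    have inj: "inj_on (\<lambda>i. b i j) (riders n M j)"
      by (rule inj_on_riders_if_present[OF assms(1) \<open>0 < v\<close> j])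
        (use present disjoint j in auto)
    have "card (riders n M j) = k"
      using assms(4) j by (auto simp: uniform_matrix_def)
    then have "card ((\<lambda>i. b i j) ` riders n M j) = card {..<k}"
      using inj by (simp add: card_image)
    moreover have "(\<lambda>i. b i j) ` riders n M j \<subseteq> {..<k}"
      using lt j by auto
    ultimately show ?thesis
      using inj by (simp add: bij_betw_def card_subset_eq)
  qed
  let ?A = "riders n M j" and ?B = "riders n M (j + 1)"
  have bijA: "bij_betw (\<lambda>i. b i j) ?A {..<k}" and bijB: "bij_betw (\<lambda>i. b i (j + 1)) ?B {..<k}"
    using bij[of j] bij[of "j + 1"] assms(6,7) by auto
  \<comment> \<open>\<open>\<phi> i\<close> is whoever rides on stage \<open>j + 1\<close> the
    bicycle that \<open>i\<close> rode on stage \<open>j\<close>.\<close>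
  define \<phi> where "\<phi> = the_inv_into ?B (\<lambda>i. b i (j + 1)) \<circ> (\<lambda>i. b i j)"
  have \<phi>: "bij_betw \<phi> ?A ?B"
    unfolding \<phi>_def using bijA bij_betw_the_inv_into[OF bijB] by (rule bij_betw_trans)
  have b_\<phi>: "b (\<phi> i) (j + 1) = b i j" if "i \<in> ?A" for i
    unfolding \<phi>_def comp_def using f_the_inv_into_f_bij_betw[OF bijB] bij_betwE[OF bijA] that by blast
  have dec: "(\<Sum>l=1..j. M (\<phi> i) l) \<le> (\<Sum>l=1..j. M i l)" if i: "i \<in> ?A" for i
  proof -
    have \<phi>i: "\<phi> i \<in> ?B" using bij_betwE[OF \<phi>] i by blast
    have "bicycle_present v w n M b (b i j) j (arrival_time v w M (\<phi> i) j)"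
      using present[of "\<phi> i" "j + 1"] \<phi>i assms(6,7) b_\<phi>[OF i] by simp
    \<comment> \<open>As \<open>j \<ge> 1\<close>, the bicycle did not start at this post, so some
      \<open>h\<close> brought it there; by injectivity on stage \<open>j\<close> this is
      \<open>i\<close>.\<close>
    then obtain h where h: "rides n M b h j (b i j)"
        "arrival_time v w M h j \<le> arrival_time v w M (\<phi> i) j"
      using assms(6) by (auto simp: bicycle_present_def)
    have "h = i"
      using h(1) i bij_betw_imp_inj_on[OF bijA] by (auto simp: rides_def inj_on_def)
    then show ?thesis
      using h(2) arrival_time_le_iff[OF assms(1-3), of i "\<phi> i" j] i \<phi>i assms(7) by auto
  qed
  obtain \<psi> where \<psi>: "bij_betw \<psi> ?A ?B"
      "\<And>i. i \<in> ?A \<Longrightarrow> (\<Sum>l=1..j. M (\<psi> i) l) \<le> (\<Sum>l=1..j. M i l)" "\<And>i. i \<in> ?A \<inter> ?B \<Longrightarrow> \<psi> i = i"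
    using bij_betw_fix_common_points[OF \<phi>, of "\<lambda>i. \<Sum>l=1..j. M i l" "?A \<inter> ?B"] dec by auto
  \<comment> \<open>Common riders are fixed by construction; conversely, a fixed point lies in the
    range \<open>?B\<close>.\<close>
  have "\<psi> i = i \<longleftrightarrow> M i (j + 1) = 1" if "i \<in> ?A" for i
    using that \<psi>(3)[of i] bij_betwE[OF \<psi>(1)] by force
  with \<psi> show thesis by (intro that[of \<psi>]) (auto simp: assignment_mapping_def)
qed

section \<open>From assignment mappings to executions\<close>

text \<open>
  \<open>\<psi> j\<close> gives the previous rider of the bicycle used on stage \<open>j + 1\<close>; for \<open>j = 0\<close> the value is
  the bicycle itself.
\<close>

primrec trace_back :: "(nat \<Rightarrow> 'a \<Rightarrow> 'a) \<Rightarrow> nat \<Rightarrow> 'a \<Rightarrow> 'a" where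
  "trace_back \<psi> 0 i = i"
| "trace_back \<psi> (Suc j) i = trace_back \<psi> j (\<psi> j i)"

lemma bij_betw_trace_back:
  assumes "\<And>j. j < n \<Longrightarrow> bij_betw (\<psi> j) (S (Suc j)) (S j)" and "j \<le> n"
  shows "bij_betw (trace_back \<psi> j) (S j) (S 0)"
  using assms(2)
proof (induction j)
  case 0
  then show ?case by (simp add: bij_betw_def inj_on_def)
next
  case (Suc j)
  have "bij_betw (trace_back \<psi> j \<circ> \<psi> j) (S (Suc j)) (S 0)"
    by (rule bij_betw_trans[OF assms(1)]) (use Suc in auto)
  moreover have "trace_back \<psi> (Suc j) = trace_back \<psi> j \<circ> \<psi> j" by auto
  ultimately show ?case by (simp only:)
qed

lemma executable_if_assignment_mappings:
  assumes "0 < w" "w < v" "binary_matrix n M" "uniform_matrix n k M"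
    and \<phi>: "\<And>j. 1 \<le> j \<Longrightarrow> j < n \<Longrightarrow> assignment_mapping n M j (\<phi> j)"
    and dec: "\<And>i j. 1 \<le> j \<Longrightarrow> j < n \<Longrightarrow> i \<in> riders n M j \<Longrightarrow>
      (\<Sum>l=1..j. M (\<phi> j i) l) \<le> (\<Sum>l=1..j. M i l)"
  shows "executable v w n M k"
proof -
  have "0 < v" using assms(1,2) by simp
  note arr_less = arrival_time_less_Suc[OF assms(1) \<open>0 < v\<close>, of M]
  \<comment> \<open>The guard is needed since for \<open>n = 0\<close> there are no riders while
    \<open>k\<close> is arbitrary.\<close>
  have "\<exists>f. 1 \<le> n \<longrightarrow> bij_betw f (riders n M 1) {..<k}"
    using assms(4) finite_same_card_bij[of "riders n M 1" "{..<k}"]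
    by (auto simp: uniform_matrix_def)
  then obtain f where f: "1 \<le> n \<Longrightarrow> bij_betw f (riders n M 1) {..<k}" by blast
  \<comment> \<open>Level 0 of the chain consists of the bicycles: \<open>f\<close> sends each rider
    of stage 1 to his bicycle. Later levels invert the \<open>\<phi> j\<close>.\<close>
  define \<psi> where "\<psi> j = (if j = 0 then f else the_inv_into (riders n M j) (\<phi> j))" for j
  define S where "S j = (if j = 0 then {..<k} else riders n M j)" for j
  have \<psi>: "bij_betw (\<psi> j) (S (Suc j)) (S j)" if "j < n" for j
    using that f \<phi>[of j] by (auto simp: \<psi>_def S_def assignment_mapping_def bij_betw_the_inv_into)
  define b where "b i j = trace_back \<psi> j i" for i j
  have bij: "bij_betw (\<lambda>i. b i j) (riders n M j) {..<k}" if "1 \<le> j" "j \<le> n" for j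
    using bij_betw_trace_back[of n \<psi> S j, OF \<psi>] that by (simp add: b_def S_def)
  have unique: "i = i'" if "rides n M b i j c" "rides n M b i' j c" for i i' j c
    using that bij_betw_imp_inj_on[OF bij[of j]] by (auto simp: rides_def inj_on_def)
  \<comment> \<open>The witness is \<open>\<psi> j i\<close>: \<open>trace_back\<close> passes
    through it, so the bicycle is the same, and (2) says that it arrives in time.\<close>
  have previous: "\<exists>h. rides n M b h j c \<and> arrival_time v w M h j \<le> arrival_time v w M i j"
    if i: "rides n M b i (Suc j) c" and j: "1 \<le> j" for i j c
  proof -
    have "j < n" "i \<in> riders n M (Suc j)" using i by (auto simp: rides_def)
    have \<phi>j: "bij_betw (\<phi> j) (riders n M j) (riders n M (Suc j))"
      using \<phi>[OF j \<open>j < n\<close>] by (simp add: assignment_mapping_def)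
    have h: "\<psi> j i \<in> riders n M j"
      using bij_betwE[OF \<psi>[OF \<open>j < n\<close>]] \<open>i \<in> riders n M (Suc j)\<close> j by (auto simp: S_def)
    have "\<phi> j (\<psi> j i) = i"
      using f_the_inv_into_f_bij_betw[OF \<phi>j] \<open>i \<in> riders n M (Suc j)\<close> j by (simp add: \<psi>_def)
    then have "arrival_time v w M (\<psi> j i) j \<le> arrival_time v w M i j"
      using dec[OF j \<open>j < n\<close> h] arrival_time_le_iff[OF assms(1-3), of "\<psi> j i" i j]
        h \<open>j < n\<close> \<open>i \<in> riders n M (Suc j)\<close> by auto
    moreover have "rides n M b (\<psi> j i) j c"
      using h i j \<open>j < n\<close> by (simp add: rides_def b_def)
    ultimately show ?thesis by blast
  qed
  \<comment> \<open>Post \<open>j'\<close> is where stage \<open>Suc j'\<close> starts, so a ride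
    ends before any ride of the same bicycle on a later stage begins. The induction steps back one
    rider with \<open>previous\<close>, then crosses his stage with \<open>arr_less\<close>.\<close>
  have chain: "arrival_time v w M i j \<le> arrival_time v w M i' j'"
    if "rides n M b i j c" "rides n M b i' (Suc j') c" "j \<le> j'" for i i' j j' c
    using that(3,2)
  proof (induction j' arbitrary: i' rule: dec_induct)
    case base
    have "1 \<le> j" using that(1) by (simp add: rides_def)
    then show ?case using previous[OF base] unique that(1) by blast
  next
    case (step m)
    obtain h where "rides n M b h (Suc m) c"
      "arrival_time v w M h (Suc m) \<le> arrival_time v w M i' (Suc m)"
      using previous[OF step.prems] by auto
    with step.IH[of h] arr_less[of h m] show ?case by linarith
  qed
  have disjoint: "{arrival_time v w M i (j - 1) <..< arrival_time v w M i j} \<inter>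
      {arrival_time v w M i' (j' - 1) <..< arrival_time v w M i' j'} = {}"
    if "rides n M b i j c" "rides n M b i' j' c" "i \<noteq> i'" for i i' j j' c
  proof -
    have pos: "Suc (j - 1) = j" "Suc (j' - 1) = j'" using that by (auto simp: rides_def)
    \<comment> \<open>Distinct riders of one bicycle use it on different stages, which
      \<open>chain\<close> separates in time.\<close>
    have "j \<noteq> j'" using unique that by blast
    then consider "j \<le> j' - 1" | "j' \<le> j - 1" by linarith
    then show ?thesis
    proof cases
      case 1
      then show ?thesis using chain[OF that(1), of i' "j' - 1"] that(2) pos by auto
    next
      case 2
      then show ?thesis using chain[OF that(2), of i "j - 1"] that(1) pos by auto
    qed
  qed
  have present: "bicycle_present v w n M b (b i j) (j - 1) (arrival_time v w M i (j - 1))"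
    if "i \<in> {1..n}" "j \<in> {1..n}" "M i j = 1" for i j
  proof -
    have r: "rides n M b i j (b i j)" using that by (simp add: rides_def)
    have pos: "Suc (j - 1) = j" using that by simp
    have "j - 1 = 0 \<and> 0 \<le> arrival_time v w M i (j - 1) \<or>
      (\<exists>h. rides n M b h (j - 1) (b i j) \<and>
        arrival_time v w M h (j - 1) \<le> arrival_time v w M i (j - 1))"
    proof (cases "j = 1")
      case True
      then show ?thesis by (simp add: arrival_time_def)
    next
      case False
      then show ?thesis using previous[of i "j - 1"] r pos that by auto
    qed
    \<comment> \<open>Only \<open>i\<close> himself takes this bicycle from post
      \<open>j - 1\<close>, so nobody has removed it earlier.\<close>
    moreover have "h = i" if "rides n M b h (j - 1 + 1) (b i j)" for h
      using unique[OF _ r] that pos by simp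
    ultimately show ?thesis unfolding bicycle_present_def by blast
  qed
  have "b i j < k" if "i \<in> {1..n}" "j \<in> {1..n}" "M i j = 1" for i j
    using bij_betwE[OF bij[of j]] that by auto
  with present disjoint show ?thesis
    unfolding executable_def by (intro exI[of _ b]) blast
qed

section \<open>The equivalence\<close>

lemma uniform_matrix_degree_le:
  assumes "uniform_matrix n k M" "1 \<le> n"
  shows "k \<le> n"
proof -
  have "card (riders n M 1) = k" using assms by (auto simp: uniform_matrix_def)
  moreover have "card (riders n M 1) \<le> card {1..n}" by (rule card_mono) auto
  ultimately show ?thesis by simp
qed

theorem theorem3p2:
  fixes n :: nat and M :: "nat \<Rightarrow> nat \<Rightarrow> nat" and v w :: real
  assumes "0 < w" and "w < v"
    and "binary_matrix n M"
  shows "optimal v w n M \<longleftrightarrow>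
    (\<exists>k. 0 \<le> k \<and> k \<le> n \<and> uniform_matrix n k M \<and>
      (\<forall>j. 1 \<le> j \<and> j \<le> n - 1 \<longrightarrow>
        (\<exists>\<phi>. assignment_mapping n M j \<phi> \<and>
          (\<forall>i\<in>{i\<in>{1..n}. M i j = 1}. \<phi> i = i \<longleftrightarrow> M i j = 1 \<and> M i (j + 1) = 1) \<and>
          (\<forall>i\<in>{i\<in>{1..n}. M i j = 1}. (\<Sum>l=1..j. M (\<phi> i) l) \<le> (\<Sum>l=1..j. M i l)))))"
    (is "_ \<longleftrightarrow> (\<exists>k. 0 \<le> k \<and> k \<le> n \<and> uniform_matrix n k M \<and> ?assign)")
proof
  assume "optimal v w n M"
  then obtain k where k: "uniform_matrix n k M" "executable v w n M k"
    unfolding optimal_def by blast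
  show "\<exists>k. 0 \<le> k \<and> k \<le> n \<and> uniform_matrix n k M \<and> ?assign"
  \<comment> \<open>For \<open>n = 0\<close> every \<open>k\<close> is uniform, so the given
    \<open>k\<close> may exceed \<open>n\<close>; the witness is then 0.\<close>
  proof (cases "n = 0")
    case True
    then show ?thesis by (simp add: uniform_matrix_def)
  next
    case False
    have ?assign
    proof (intro allI impI)
      fix j assume "1 \<le> j \<and> j \<le> n - 1"
      then have j: "1 \<le> j" "j < n" by auto
      obtain \<phi> where "assignment_mapping n M j \<phi>"
        and "\<And>i. i \<in> riders n M j \<Longrightarrow> (\<Sum>l=1..j. M (\<phi> i) l) \<le> (\<Sum>l=1..j. M i l)"
        and "\<And>i. i \<in> riders n M j \<Longrightarrow> \<phi> i = i \<longleftrightarrow> M i (j + 1) = 1"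
        by (rule assignment_mapping_if_executable[OF assms k j]) (rule that)
      then show "\<exists>\<phi>. assignment_mapping n M j \<phi> \<and>
          (\<forall>i\<in>riders n M j. \<phi> i = i \<longleftrightarrow> M i j = 1 \<and> M i (j + 1) = 1) \<and>
          (\<forall>i\<in>riders n M j. (\<Sum>l=1..j. M (\<phi> i) l) \<le> (\<Sum>l=1..j. M i l))"
        by (intro exI[of _ \<phi>]) simp
    qed
    then show ?thesis
      using k(1) uniform_matrix_degree_le[OF k(1)] False by (intro exI[of _ k]) simp
  qed
next
  assume "\<exists>k. 0 \<le> k \<and> k \<le> n \<and> uniform_matrix n k M \<and> ?assign"
  then obtain k where k: "uniform_matrix n k M" and assign: ?assign by blast
  have "1 \<le> j \<and> j \<le> n - 1" if "1 \<le> j \<and> j < n" for j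
    using that by linarith
  \<comment> \<open>The range condition on \<open>j\<close> moves inside the existential so that
    \<open>choice\<close> applies to all \<open>j\<close>.\<close>
  with assign have "\<forall>j. \<exists>\<phi>. 1 \<le> j \<and> j < n \<longrightarrow> assignment_mapping n M j \<phi> \<and>
      (\<forall>i\<in>riders n M j. (\<Sum>l=1..j. M (\<phi> i) l) \<le> (\<Sum>l=1..j. M i l))"
    by blast
  from choice[OF this] obtain \<phi> where "\<forall>j. 1 \<le> j \<and> j < n \<longrightarrow> assignment_mapping n M j (\<phi> j) \<and>
      (\<forall>i\<in>riders n M j. (\<Sum>l=1..j. M (\<phi> j i) l) \<le> (\<Sum>l=1..j. M i l))"
    by blast
  then have "executable v w n M k"
    by (intro executable_if_assignment_mappings[OF assms k, of \<phi>]) blast+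
  then show "optimal v w n M" using k unfolding optimal_def by blast
qed

end
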